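(* Let $p$ be an odd prime and let $q\in\mathbb{C}_p$ with $|1-q|_p<1$. For $n,k\in\mathbb{Z}_+$ with $n>k$, $$\int_{\mathbb{Z}_p}q^{1-x}B_{k,n}(x)\,d\mu_{-1}(x)=\begin{cases}2q+E_{n,q}, & k=0,\\[1mm] \binom{n}{k}\displaystyle\sum_{j=0}^{k}\binom{k}{j}(-1)^{k-j}E_{n-j,q}, & k>0.\end{cases}$$
   Context: $\mathbb{C}_p$ denotes the completion of an algebraic closure of $\mathbb{Q}_p$; $\mathbb{Z}_+=\{0,1,2,\dots\}$. For $q\in\mathbb{C}_p$ with $|1-q|_p<1$, the $q$-Euler numbers $E_{n,q}$ are defined by $\frac{2}{qe^t+1}=\sum_{n\ge0}E_{n,q}\frac{t^n}{n!}$ (formal power series in $t$). For $x\in\mathbb{Z}_p$, $q^x=\sum_{m\ge0}\binom{x}{m}(q-1)^m$ and $q^{1-x}=q\cdot(q^{-1})^x$. The Bernstein polynomial is $B_{k,n}(x)=\binom{n}{k}x^k(1-x)^{n-k}$ for $0\le k\le n$, regarded as a polynomial function on $\mathbb{Z}_p$. For a uniformly differentiable $f:\mathbb{Z}_p\to\mathbb{C}_p$, the fermionic $p$-adic integral is $\int_{\mathbb{Z}_p}f(x)\,d\mu_{-1}(x)=\lim_{N\to\infty}\sum_{x=0}^{p^N-1}f(x)(-1)^x$. *)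

theory Defs
  imports "HOL-Analysis.Analysis" "HOL-Computational_Algebra.Computational_Algebra"
begin

text \<open>
  The closure of the prime field is \<open>\<rat>\<^sub>p\<close> when the ambient field is complete and its
  absolute value restricts to the \<open>p\<close>-adic one on \<open>\<rat>\<close>; the elements algebraic over it
  form the algebraic closure of \<open>\<rat>\<^sub>p\<close> inside the ambient field.
\<close>

definition padic_numbers :: "'a::{field_char_0, metric_space} set" where
  "padic_numbers = closure (range of_rat)"

definition padic_algebraic :: "'a::{field_char_0, metric_space} set" where
  "padic_algebraic =
     {x. \<exists>f. f \<noteq> 0 \<and> (\<forall>i. poly.coeff f i \<in> padic_numbers) \<and> poly f x = 0}"

text \<open>
  The type \<open>'a\<close> with absolute value \<open>absp\<close> is \<open>\<complex>\<^sub>p\<close>: a complete field (class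
  \<open>complete_space\<close>) in which an algebraic closure of \<open>\<rat>\<^sub>p\<close> is dense. This determines
  \<open>'a\<close> up to isometric isomorphism. An ultrametric multiplicative absolute value with
  \<open>absp p = 1/p\<close> necessarily restricts to the normalised \<open>p\<close>-adic absolute value on \<open>\<rat>\<close>.
\<close>

locale padic_complex_numbers =
  fixes p :: nat and absp :: "'a::{field_char_0, complete_space} \<Rightarrow> real"
  assumes prime_p: "prime p"
    and dist_absp: "dist x y = absp (x - y)"
    and absp_mult: "absp (x * y) = absp x * absp y"
    and absp_add_le: "absp (x + y) \<le> max (absp x) (absp y)"
    and absp_p: "absp (of_nat p) = 1 / real p"
    and padic_algebraic_closed:
      "\<And>f :: 'a poly. degree f > 0 \<Longrightarrow> (\<forall>i. poly.coeff f i \<in> padic_algebraic) \<Longrightarrow>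
         \<exists>x\<in>padic_algebraic. poly f x = 0"
    and padic_algebraic_dense: "closure padic_algebraic = (UNIV :: 'a set)"

definition q_euler :: "nat \<Rightarrow> 'a::field_char_0 \<Rightarrow> 'a" where
  "q_euler n q = fact n * fps_nth (2 / (fps_const q * fps_exp 1 + 1)) n"

text \<open>The power \<open>q\<^sup>x\<close> for \<open>|1 - q| < 1\<close> and \<open>x \<in> \<int>\<^sub>p\<close>.\<close>

definition padic_pow :: "'a::{field_char_0, metric_space} \<Rightarrow> 'a \<Rightarrow> 'a" where
  "padic_pow q x = (\<Sum>m. (x gchoose m) * (q - 1) ^ m)"

definition bernstein_poly :: "nat \<Rightarrow> nat \<Rightarrow> 'a::comm_ring_1 \<Rightarrow> 'a" where
  "bernstein_poly k n x = of_nat (n choose k) * x ^ k * (1 - x) ^ (n - k)"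

text \<open>
  \<open>has_fermionic_integral p f I\<close>: the limit defining the fermionic \<open>p\<close>-adic integral of
  \<open>f\<close> over \<open>\<int>\<^sub>p\<close> exists and equals \<open>I\<close>. Only the values of \<open>f\<close> at natural numbers enter.
\<close>

definition has_fermionic_integral ::
    "nat \<Rightarrow> ('a::{field_char_0, metric_space} \<Rightarrow> 'a) \<Rightarrow> 'a \<Rightarrow> bool" where
  "has_fermionic_integral p f I \<longleftrightarrow>
     (\<lambda>N. \<Sum>x<p ^ N. f (of_nat x) * (-1) ^ x) \<longlonglongrightarrow> I"

end

theory Submission imports Defs begin

text \<open>
  Let \<open>P\<^sub>m(y)\<close> be the \<open>q\<close>-Euler polynomials, with exponential generating function
  \<open>2 e\<^sup>y\<^sup>t / (q e\<^sup>t + 1)\<close>. Then \<open>q P\<^sub>m(y + 1) + P\<^sub>m(y) = 2 y\<^sup>m\<close>, so for \<open>G(y) = q\<^sup>y P\<^sub>m(y)\<close> the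
  alternating sum of \<open>2 q\<^sup>1\<^sup>-\<^sup>x (1 - x)\<^sup>m = G(2 - x) + G(1 - x)\<close> over \<open>x < p\<^sup>N\<close> telescopes to
  \<open>G(2) + G(2 - p\<^sup>N)\<close>, which tends to \<open>2 G(2)\<close>. Two further applications of the functional
  equation give \<open>G(2) = 2 q + E\<^sub>m\<close> for \<open>m > 0\<close>. Finally \<open>B\<^sub>k\<^sub>,\<^sub>n(x)\<close> is expanded in powers
  of \<open>1 - x\<close>; for \<open>k > 0\<close> the terms \<open>2 q\<close> cancel because the coefficients add up to
  \<open>(1 - 1)\<^sup>k = 0\<close>.
\<close>

section \<open>q-Euler polynomials\<close>

definition q_euler_poly :: "nat \<Rightarrow> 'a::field_char_0 \<Rightarrow> 'a \<Rightarrow> 'a" where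
  "q_euler_poly m q y =
     fact m * fps_nth (2 / (fps_const q * fps_exp 1 + 1) * fps_exp y) m"

lemma q_euler_poly_0: "q_euler_poly m q 0 = q_euler m q"
  by (simp add: q_euler_poly_def q_euler_def)

text \<open>The Cauchy product exhibits the value as a polynomial in \<open>y\<close>; this form
  yields continuity in \<open>y\<close>.\<close>

lemma q_euler_poly_eq_sum:
  "q_euler_poly m q y =
     (\<Sum>i=0..m. fact m * fps_nth (2 / (fps_const q * fps_exp 1 + 1)) i / fact (m - i) * y ^ (m - i))"
  by (simp add: q_euler_poly_def fps_mult_nth sum_distrib_left mult.assoc)

lemma q_euler_poly_functional_equation:
  fixes q y :: "'a::field_char_0"
  assumes "q + 1 \<noteq> 0"
  shows "q * q_euler_poly m q (y + 1) + q_euler_poly m q y = 2 * y ^ m"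
proof -
  define D :: "'a fps" where "D = fps_const q * fps_exp 1 + 1"
  \<comment> \<open>The constant coefficient of \<open>D\<close> is \<open>q + 1\<close>, so
    \<open>D\<close> is a unit and the division is exact.\<close>
  have "fps_nth D 0 \<noteq> 0"
    using assms by (simp add: D_def)
  hence AD: "2 / D * D = 2"
    by (simp add: fps_divide_unit mult.assoc inverse_mult_eq_1)
  \<comment> \<open>Shifting \<open>y\<close> by 1 multiplies the generating function by
    \<open>fps_exp 1\<close>, so the left side contains the factor \<open>D\<close>, which cancels
    the denominator.\<close>
  have "fps_const q * (2 / D * fps_exp (y + 1)) + 2 / D * fps_exp y
      = (2 / D * D) * fps_exp y"
    unfolding fps_exp_add_mult by (simp add: D_def algebra_simps)
  also have "\<dots> = fps_const 2 * fps_exp y"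
    unfolding AD by (simp add: numeral_fps_const)
  finally have "fps_nth (fps_const q * (2 / D * fps_exp (y + 1)) + 2 / D * fps_exp y) m
      = 2 * y ^ m / fact m"
    by simp
  hence "q * fps_nth (2 / D * fps_exp (y + 1)) m + fps_nth (2 / D * fps_exp y) m
      = 2 * y ^ m / fact m"
    by (simp only: fps_add_nth fps_mult_left_const_nth)
  thus ?thesis
    unfolding q_euler_poly_def D_def [symmetric] by (simp add: field_simps)
qed

lemma q_euler_poly_2:
  fixes q :: "'a::field_char_0"
  assumes "q + 1 \<noteq> 0" and "m > 0"
  shows "q\<^sup>2 * q_euler_poly m q 2 = 2 * q + q_euler m q"
proof -
  have "q * q_euler_poly m q 2 = 2 - q_euler_poly m q 1"
    using q_euler_poly_functional_equation [OF assms(1), of m 1] by (simp add: algebra_simps)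
  \<comment> \<open>At \<open>y = 0\<close> the right side \<open>2 * 0 ^ m\<close> vanishes because
    \<open>m > 0\<close>.\<close>
  moreover have "q * q_euler_poly m q 1 = - q_euler m q"
    using q_euler_poly_functional_equation [OF assms(1), of m 0] assms(2)
    by (simp add: algebra_simps q_euler_poly_0 eq_neg_iff_add_eq_0)
  ultimately show ?thesis
    by (simp add: power2_eq_square mult.assoc right_diff_distrib)
qed

section \<open>Finite sums and binomial expansions\<close>

lemma alternating_sum_telescope:
  fixes g :: "nat \<Rightarrow> 'a::comm_ring_1"
  shows "(\<Sum>x<M. (g x + g (Suc x)) * (-1) ^ x) = g 0 - (-1) ^ M * g M"
  by (induction M) (simp_all add: algebra_simps)

text \<open>The coefficient \<open>x gchoose m\<close> is zero for \<open>m > x\<close>, so the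
  series is the finite binomial expansion of \<open>((q - 1) + 1) ^ x\<close>.\<close>

lemma padic_pow_of_nat:
  fixes q :: "'a::{field_char_0, metric_space}"
  shows "padic_pow q (of_nat x) = q ^ x"
proof -
  have "padic_pow q (of_nat x) = (\<Sum>m\<le>x. (of_nat x gchoose m) * (q - 1) ^ m)"
    unfolding padic_pow_def
    by (rule suminf_finite) (auto simp: binomial_gbinomial [symmetric] not_le)
  also have "\<dots> = ((q - 1) + 1) ^ x"
    by (subst binomial_ring) (simp add: binomial_gbinomial)
  finally show ?thesis by simp
qed

lemma bernstein_poly_expand:
  fixes x :: "'a::comm_ring_1"
  assumes "k \<le> n"
  shows "bernstein_poly k n x =
    of_nat (n choose k) * (\<Sum>j=0..k. of_nat (k choose j) * (-1) ^ (k - j) * (1 - x) ^ (n - j))"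
proof -
  have "x ^ k = (1 + - (1 - x)) ^ k" by simp
  also have "\<dots> = (\<Sum>j\<le>k. of_nat (k choose j) * (- (1 - x)) ^ (k - j))"
    by (subst binomial_ring) simp
  finally have "x ^ k * (1 - x) ^ (n - k) =
      (\<Sum>j\<le>k. of_nat (k choose j) * (- (1 - x)) ^ (k - j) * (1 - x) ^ (n - k))"
    by (simp add: sum_distrib_right)
  also have "\<dots> = (\<Sum>j=0..k. of_nat (k choose j) * (-1) ^ (k - j) * (1 - x) ^ (n - j))"
  proof (rule sum.cong)
    fix j assume "j \<in> {0..k}"
    hence "n - j = (k - j) + (n - k)" using assms by simp
    thus "of_nat (k choose j) * (- (1 - x)) ^ (k - j) * (1 - x) ^ (n - k)
        = of_nat (k choose j) * (-1) ^ (k - j) * (1 - x) ^ (n - j)"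
      by (subst power_minus) (simp add: power_add mult.assoc)
  qed auto
  finally show ?thesis
    by (simp add: bernstein_poly_def mult.assoc)
qed

lemma sum_choose_alternating:
  "(\<Sum>j=0..k. of_nat (k choose j) * (-1) ^ (k - j)) = (if k = 0 then 1 else 0 :: 'a::comm_ring_1)"
proof -
  have "(1 + - 1 :: 'a) ^ k = (\<Sum>j\<le>k. of_nat (k choose j) * (-1) ^ (k - j))"
    by (subst binomial_ring) simp
  thus ?thesis by (simp add: atLeast0AtMost power_0_left)
qed

section \<open>The ultrametric absolute value\<close>

context padic_complex_numbers
begin

lemma absp_0 [simp]: "absp 0 = 0"
  using dist_absp [of 0 0] by simp

lemma absp_eq_0_iff [simp]: "absp x = 0 \<longleftrightarrow> x = 0"
  by (metis diff_zero dist_absp dist_eq_0_iff)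

lemma absp_nonneg [simp]: "absp x \<ge> 0"
  using dist_absp [of x 0] by (metis diff_zero zero_le_dist)

lemma absp_1 [simp]: "absp 1 = 1"
  using absp_mult [of 1 1] by simp

lemma absp_minus_commute: "absp (x - y) = absp (y - x)"
  by (metis dist_absp dist_commute)

lemma absp_minus [simp]: "absp (- x) = absp x"
  using absp_minus_commute [of 0 x] by simp

lemma absp_diff_le: "absp (x - y) \<le> max (absp x) (absp y)"
  using absp_add_le [of x "- y"] by simp

lemma absp_triangle: "absp (x + y) \<le> absp x + absp y"
  using absp_add_le [of x y] absp_nonneg [of x] absp_nonneg [of y] by linarith

lemma absp_power: "absp (x ^ n) = absp x ^ n"
  by (induction n) (simp_all add: absp_mult)

lemma absp_inverse: "absp (inverse x) = inverse (absp x)"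
proof (cases "x = 0")
  case False
  hence "absp x * absp (inverse x) = 1"
    by (simp add: absp_mult [symmetric])
  thus ?thesis by (simp add: inverse_unique)
qed simp

lemma absp_sum_le:
  assumes "\<And>i. i \<in> A \<Longrightarrow> absp (f i) \<le> B" and "B \<ge> 0"
  shows "absp (sum f A) \<le> B"
  using assms
proof (induction A rule: infinite_finite_induct)
  case (insert a A)
  have "absp (sum f A) \<le> B" "absp (f a) \<le> B"
    using insert by auto
  hence "absp (f a + sum f A) \<le> B"
    using absp_add_le [of "f a" "sum f A"] by linarith
  thus ?case using insert by simp
qed auto

lemma absp_of_nat_le_1: "absp (of_nat n) \<le> 1"
  using absp_sum_le [of "{..<n}" "\<lambda>_. 1" 1] by simp

section \<open>Limit laws\<close>

lemma tendsto_iff_absp: "X \<longlonglongrightarrow> l \<longleftrightarrow> (\<lambda>N. absp (X N - l)) \<longlonglongrightarrow> 0"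
  by (simp add: tendsto_dist_iff [of X] dist_absp)

text \<open>The metric is linked to the field operations only through \<open>absp\<close>, so the
  limit laws are derived from its triangle inequality and multiplicativity.\<close>

lemma tendsto_add_absp:
  fixes a b :: 'a
  assumes "X \<longlonglongrightarrow> a" and "Y \<longlonglongrightarrow> b"
  shows "(\<lambda>N. X N + Y N) \<longlonglongrightarrow> a + b"
  unfolding tendsto_iff_absp
proof (rule Lim_null_comparison)
  show "(\<lambda>N. absp (X N - a) + absp (Y N - b)) \<longlonglongrightarrow> 0"
    using assms tendsto_add_zero unfolding tendsto_iff_absp by blast
  have "absp (X N + Y N - (a + b)) \<le> absp (X N - a) + absp (Y N - b)" for N
    using absp_triangle [of "X N - a" "Y N - b"] by (simp add: algebra_simps)
  thus "\<forall>\<^sub>F N in sequentially. norm (absp (X N + Y N - (a + b))) \<le> absp (X N - a) + absp (Y N - b)"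
    by simp
qed

lemma tendsto_mult_absp:
  fixes a b :: 'a
  assumes "X \<longlonglongrightarrow> a" and "Y \<longlonglongrightarrow> b"
  shows "(\<lambda>N. X N * Y N) \<longlonglongrightarrow> a * b"
  unfolding tendsto_iff_absp
proof (rule Lim_null_comparison)
  let ?x = "\<lambda>N. absp (X N - a)" and ?y = "\<lambda>N. absp (Y N - b)"
  have "(\<lambda>N. ?x N * ?y N + (?x N * absp b + absp a * ?y N)) \<longlonglongrightarrow> 0 * 0 + (0 * absp b + absp a * 0)"
    using assms unfolding tendsto_iff_absp by (intro tendsto_intros)
  thus "(\<lambda>N. ?x N * ?y N + (?x N * absp b + absp a * ?y N)) \<longlonglongrightarrow> 0" by simp
  have "absp (X N * Y N - a * b) \<le> ?x N * ?y N + (?x N * absp b + absp a * ?y N)" for N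
  proof -
    have "X N * Y N - a * b = (X N - a) * (Y N - b) + ((X N - a) * b + a * (Y N - b))"
      by (simp add: algebra_simps)
    thus ?thesis
      using absp_triangle [of "(X N - a) * (Y N - b)" "(X N - a) * b + a * (Y N - b)"]
        absp_triangle [of "(X N - a) * b" "a * (Y N - b)"]
      by (simp add: absp_mult)
  qed
  thus "\<forall>\<^sub>F N in sequentially. norm (absp (X N * Y N - a * b))
      \<le> ?x N * ?y N + (?x N * absp b + absp a * ?y N)"
    by simp
qed

lemma tendsto_sum_absp:
  fixes a :: "'b \<Rightarrow> 'a"
  assumes "\<And>i. i \<in> A \<Longrightarrow> (\<lambda>N. X i N) \<longlonglongrightarrow> a i"
  shows "(\<lambda>N. \<Sum>i\<in>A. X i N) \<longlonglongrightarrow> (\<Sum>i\<in>A. a i)"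
  using assms
  by (induction A rule: infinite_finite_induct) (auto intro: tendsto_add_absp)

lemma tendsto_power_absp:
  fixes a :: 'a
  assumes "X \<longlonglongrightarrow> a"
  shows "(\<lambda>N. X N ^ m) \<longlonglongrightarrow> a ^ m"
  by (induction m) (auto intro: tendsto_mult_absp assms)

lemma tendsto_q_euler_poly:
  fixes q y :: 'a
  assumes "X \<longlonglongrightarrow> y"
  shows "(\<lambda>N. q_euler_poly m q (X N)) \<longlonglongrightarrow> q_euler_poly m q y"
  unfolding q_euler_poly_eq_sum
  by (intro tendsto_sum_absp tendsto_mult_absp tendsto_power_absp tendsto_const assms)

section \<open>Limits along the exponents p^N\<close>

lemma of_nat_power_tendsto_0: "(\<lambda>N. of_nat (p ^ N) :: 'a) \<longlonglongrightarrow> 0"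
proof -
  have "(\<lambda>N. (1 / real p) ^ N) \<longlonglongrightarrow> 0"
    using prime_gt_1_nat [OF prime_p] by (intro LIMSEQ_power_zero) simp
  thus ?thesis
    unfolding tendsto_iff_absp by (simp add: absp_power absp_p)
qed

text \<open>\<open>u - 1\<close> divides \<open>u ^ i - 1\<close>, and the cofactor is a sum of
  powers of \<open>u\<close>, hence of absolute value at most 1.\<close>

lemma absp_power_minus_1_le:
  assumes "absp u = 1"
  shows "absp (u ^ i - 1) \<le> absp (u - 1)"
proof -
  have "absp (\<Sum>j<i. u ^ j) \<le> 1"
    by (rule absp_sum_le) (simp_all add: absp_power assms)
  thus ?thesis
    by (simp add: power_diff_1_eq absp_mult mult_left_le)
qed

text \<open>The cofactor of \<open>u - 1\<close> in \<open>u ^ p - 1\<close> is a sum of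
  \<open>p\<close> powers of \<open>u\<close>. Each is within \<open>absp (u - 1)\<close> of 1, so
  the sum differs from \<open>p\<close> by at most that much.\<close>

lemma absp_power_p_minus_1_le:
  assumes "absp u = 1"
  shows "absp (u ^ p - 1) \<le> absp (u - 1) * max (1 / real p) (absp (u - 1))"
proof -
  have "absp (\<Sum>j<p. u ^ j - 1) \<le> absp (u - 1)"
    by (rule absp_sum_le) (simp_all add: absp_power_minus_1_le assms)
  moreover have "(\<Sum>j<p. u ^ j) = of_nat p + (\<Sum>j<p. u ^ j - 1)"
    by (simp add: sum_subtractf)
  ultimately have "absp (\<Sum>j<p. u ^ j) \<le> max (1 / real p) (absp (u - 1))"
    using absp_add_le [of "of_nat p" "\<Sum>j<p. u ^ j - 1"] by (auto simp: absp_p)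
  thus ?thesis
    by (simp add: power_diff_1_eq absp_mult mult_left_mono)
qed

text \<open>Each \<open>p\<close>-th power brings the element closer to 1 by a factor of at most
  \<open>c < 1\<close>.\<close>

lemma power_p_power_tendsto_1:
  assumes "absp u = 1" and "absp (u - 1) < 1"
  shows "(\<lambda>N. u ^ (p ^ N)) \<longlonglongrightarrow> 1"
proof -
  define c where "c = max (1 / real p) (absp (u - 1))"
  have c: "0 \<le> c" "c < 1"
    using assms prime_gt_1_nat [OF prime_p] by (auto simp: c_def le_max_iff_disj)
  have bound: "absp (u ^ (p ^ N) - 1) \<le> c ^ N" for N
  proof (induction N)
    case 0
    show ?case using assms by simp
  next
    case (Suc N)
    let ?v = "u ^ (p ^ N)"
    have v: "absp ?v = 1" by (simp add: absp_power assms)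
    have "absp (u ^ (p ^ Suc N) - 1) = absp (?v ^ p - 1)"
      by (simp add: power_mult [symmetric] mult.commute)
    also have "\<dots> \<le> absp (?v - 1) * max (1 / real p) (absp (?v - 1))"
      by (rule absp_power_p_minus_1_le [OF v])
    \<comment> \<open>Since \<open>?v\<close> is no farther from 1 than \<open>u\<close>, the same
      \<open>c\<close> works at every level.\<close>
    also have "\<dots> \<le> c ^ N * c"
      using Suc absp_power_minus_1_le [OF assms(1), of "p ^ N"] c
      by (intro mult_mono) (auto simp: c_def le_max_iff_disj)
    finally show ?case by (simp add: mult.commute)
  qed
  show ?thesis
    unfolding tendsto_iff_absp
    by (rule Lim_null_comparison [OF _ LIMSEQ_power_zero [of c]]) (use bound c in auto)
qed

section \<open>Consequences of p odd and q close to 1\<close>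

lemma absp_2:
  assumes "odd p"
  shows "absp 2 = 1"
proof (rule antisym)
  show "absp 2 \<le> 1" using absp_of_nat_le_1 [of 2] by simp
  obtain j where j: "p = 2 * j + 1" using assms by (rule oddE)
  \<comment> \<open>Here 1 is written as \<open>p - 2 * j\<close>; as \<open>p\<close> has absolute
    value below 1, the other term must reach 1.\<close>
  have "1 \<le> max (absp (of_nat p)) (absp (2 * of_nat j))"
    using absp_diff_le [of "of_nat p" "2 * of_nat j"] by (simp add: j)
  moreover have "absp (of_nat p) < 1"
    using prime_gt_1_nat [OF prime_p] by (simp add: absp_p)
  moreover have "absp (2 * of_nat j) \<le> absp 2"
    by (simp add: absp_mult absp_of_nat_le_1 mult_left_le)
  ultimately show "1 \<le> absp 2" by linarith
qed

lemma absp_eq_1_if_close: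
  assumes "absp (1 - q) < 1"
  shows "absp q = 1"
proof (rule antisym)
  show "absp q \<le> 1"
    using absp_diff_le [of 1 "1 - q"] assms by simp
  show "1 \<le> absp q"
    using absp_add_le [of "1 - q" q] assms by simp
qed

lemma add_1_nonzero_if_close:
  assumes "odd p" and "absp (1 - q) < 1"
  shows "q + 1 \<noteq> 0"
proof
  assume "q + 1 = 0"
  hence "q = - 1" by (simp add: eq_neg_iff_add_eq_0)
  \<comment> \<open>For \<open>q = -1\<close> the difference \<open>1 - q\<close> is 2, of absolute
    value 1.\<close>
  thus False using assms absp_2 by simp
qed

section \<open>Fermionic integrals\<close>

lemma fermionic_sum_one_minus_power:
  assumes "odd p" and "absp (1 - q) < 1" and "m > 0"
  shows "(\<lambda>N. \<Sum>x<p ^ N. q * inverse q ^ x * (1 - of_nat x) ^ m * (-1) ^ x)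
           \<longlonglongrightarrow> 2 * q + q_euler m q"
proof -
  note q1 = add_1_nonzero_if_close [OF assms(1,2)]
  have absq: "absp q = 1" by (rule absp_eq_1_if_close [OF assms(2)])
  hence q0: "q \<noteq> 0" by auto
  \<comment> \<open>This is \<open>G(2 - x)\<close>, with \<open>q\<close> to the power
    \<open>2 - x\<close> split so that all exponents are natural numbers.\<close>
  define g where "g x = q\<^sup>2 * inverse q ^ x * q_euler_poly m q (2 - of_nat x)" for x :: nat
  have g: "2 * (q * inverse q ^ x * (1 - of_nat x) ^ m) = g x + g (Suc x)" for x
  proof -
    have "g x + g (Suc x) = q * inverse q ^ x *
        (q * q_euler_poly m q (1 - of_nat x + 1) + q_euler_poly m q (1 - of_nat x))"
      using q0 by (simp add: g_def power2_eq_square algebra_simps)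
    thus ?thesis
      unfolding q_euler_poly_functional_equation [OF q1] by simp
  qed
  have sums: "(\<Sum>x<p ^ N. q * inverse q ^ x * (1 - of_nat x) ^ m * (-1) ^ x)
      = (1 / 2) * (g 0 + g (p ^ N))" for N
  proof -
    have "2 * (\<Sum>x<p ^ N. q * inverse q ^ x * (1 - of_nat x) ^ m * (-1) ^ x)
        = (\<Sum>x<p ^ N. (g x + g (Suc x)) * (-1) ^ x)"
      by (simp add: sum_distrib_left g [symmetric] mult.assoc)
    \<comment> \<open>\<open>p ^ N\<close> is odd, so the final term of the telescoped sum enters
      with a plus sign.\<close>
    also have "\<dots> = g 0 + g (p ^ N)"
      using assms(1) by (simp add: alternating_sum_telescope)
    finally show ?thesis by (simp add: mult.commute)
  qed
  \<comment> \<open>The inverse of \<open>q\<close> is as close to 1 as \<open>q\<close> itself, so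
    its \<open>p ^ N\<close>-th powers tend to 1.\<close>
  have "absp (inverse q - 1) = absp (inverse q * (1 - q))"
    using q0 by (simp add: algebra_simps)
  hence r: "absp (inverse q - 1) < 1"
    using assms(2) absq by (simp add: absp_mult absp_inverse)
  have "(\<lambda>N. 2 + (-1) * of_nat (p ^ N)) \<longlonglongrightarrow> 2 + (-1) * (0 :: 'a)"
    by (intro tendsto_add_absp tendsto_mult_absp tendsto_const of_nat_power_tendsto_0)
  hence "(\<lambda>N. 2 - of_nat (p ^ N)) \<longlonglongrightarrow> (2 :: 'a)" by simp
  hence "(\<lambda>N. g (p ^ N)) \<longlonglongrightarrow> q\<^sup>2 * 1 * q_euler_poly m q 2"
    unfolding g_def using r absq
    by (intro tendsto_mult_absp tendsto_const tendsto_q_euler_poly power_p_power_tendsto_1)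
      (auto simp: absp_inverse)
  hence "(\<lambda>N. (1 / 2) * (g 0 + g (p ^ N))) \<longlonglongrightarrow> (1 / 2) * (g 0 + q\<^sup>2 * 1 * q_euler_poly m q 2)"
    by (intro tendsto_mult_absp tendsto_add_absp tendsto_const)
  \<comment> \<open>\<open>g 0\<close> equals the limit of \<open>g (p ^ N)\<close>, so the factor
    \<open>1 / 2\<close> cancels.\<close>
  moreover have "(1 / 2) * (g 0 + q\<^sup>2 * 1 * q_euler_poly m q 2) = 2 * q + q_euler m q"
    using q_euler_poly_2 [OF q1 assms(3)] by (simp add: g_def)
  ultimately show ?thesis
    unfolding sums by (simp only:)
qed

end

theorem theorem4:
  fixes p n k :: nat
    and absp :: "'a::{field_char_0, complete_space} \<Rightarrow> real"
    and q :: 'a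
  assumes "prime p" and "odd p"
    and "padic_complex_numbers p absp"
    and "absp (1 - q) < 1"
    and "n > k"
  shows "has_fermionic_integral p
           (\<lambda>x. q * padic_pow (inverse q) x * bernstein_poly k n x)
           (if k = 0 then 2 * q + q_euler n q
            else of_nat (n choose k) *
              (\<Sum>j=0..k. of_nat (k choose j) * (-1) ^ (k - j) * q_euler (n - j) q))"
proof -
  interpret padic_complex_numbers p absp by fact
  define S where
    "S m N = (\<Sum>x<p ^ N. q * inverse q ^ x * (1 - of_nat x) ^ m * (-1) ^ x)" for m N
  define c :: "nat \<Rightarrow> 'a" where "c j = of_nat (k choose j) * (-1) ^ (k - j)" for j
  have sums: "(\<Sum>x<p ^ N. q * padic_pow (inverse q) (of_nat x) * bernstein_poly k n (of_nat x) * (-1) ^ x)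
      = of_nat (n choose k) * (\<Sum>j=0..k. c j * S (n - j) N)" for N
  proof -
    have "(\<Sum>j=0..k. c j * S (n - j) N) = (\<Sum>x<p ^ N. \<Sum>j=0..k.
        c j * (q * inverse q ^ x * (1 - of_nat x) ^ (n - j) * (-1) ^ x))"
      unfolding S_def sum_distrib_left by (rule sum.swap)
    thus ?thesis
      using assms(5)
      by (simp add: padic_pow_of_nat bernstein_poly_expand c_def sum_distrib_left
          sum_distrib_right mult_ac)
  qed
  \<comment> \<open>\<open>n > k\<close> keeps every exponent \<open>n - j\<close> positive, as the
    limit formula requires.\<close>
  have "S (n - j) \<longlonglongrightarrow> 2 * q + q_euler (n - j) q" if "j \<in> {0..k}" for j
    unfolding S_def using that assms by (intro fermionic_sum_one_minus_power) auto
  hence lim: "(\<lambda>N. of_nat (n choose k) * (\<Sum>j=0..k. c j * S (n - j) N))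
      \<longlonglongrightarrow> of_nat (n choose k) * (\<Sum>j=0..k. c j * (2 * q + q_euler (n - j) q))"
    by (intro tendsto_mult_absp tendsto_sum_absp tendsto_const)
  have "(\<Sum>j=0..k. c j * (2 * q + q_euler (n - j) q))
      = (\<Sum>j=0..k. c j) * (2 * q) + (\<Sum>j=0..k. c j * q_euler (n - j) q)"
    by (simp add: distrib_left sum.distrib sum_distrib_right)
  \<comment> \<open>This is the source of the case distinction: \<open>2 * q\<close> survives only
    for \<open>k = 0\<close>.\<close>
  also have "(\<Sum>j=0..k. c j) = (if k = 0 then 1 else 0)"
    unfolding c_def by (rule sum_choose_alternating)
  finally have "of_nat (n choose k) * (\<Sum>j=0..k. c j * (2 * q + q_euler (n - j) q))
      = (if k = 0 then 2 * q + q_euler n q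
         else of_nat (n choose k) * (\<Sum>j=0..k. c j * q_euler (n - j) q))"
    by (auto simp: c_def)
  with lim show ?thesis
    unfolding has_fermionic_integral_def sums c_def by simp
qed

end
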